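(* The natural deduction system $\mathbf{NS}_C$ is sound and complete for the classical interpretation of the Sheffer stroke $\mid$. That is, for every finite set $\Gamma$ of formulas and every formula $A$ (of the propositional language whose only connective is $\mid$), there is a derivation in $\mathbf{NS}_C$ of $A$ all of whose open assumptions belong to $\Gamma$ if and only if every classical truth-value assignment that makes all formulas in $\Gamma$ true also makes $A$ true.
   Context: Formulas are built from propositional variables using the single binary connective $\mid$ (the Sheffer stroke): every propositional variable is a formula, and if $A$, $B$ are formulas so is $A \mid B$. The symbol $\bot$ is not a formula; it is a placeholder used in natural deduction derivations for an empty conclusion. Classical interpretation: a truth-value assignment assigns true or false to each propositional variable and is extended to all formulas by: $A \mid B$ is true if and only if $A$ is false or $B$ is false. Natural deduction system $\mathbf{NS}_C$. Derivations are Gentzen-style trees whose leaves are assumptions (formulas) and whose other nodes are formulas or $\bot$, built using the following rules. A single assumption $A$ counts as a derivation of $A$ depending on the open assumption $A$. - ${\mid}I$: from a derivation of $\bot$, infer $A \mid B$, discharging any number (possibly zero) of open assumptions of the form $A$ and any number (possibly zero) of open assumptions of the form $B$. - ${\mid}E$: from derivations of $A \mid B$, of $A$, and of $B$, infer $\bot$. - $\bot_I$: from a derivation of $\bot$, infer any formula $A$. - ${\mid}E_C$: from a derivation of $\bot$, infer a formula $A$, discharging any number (possibly zero) of open assumptions of the form $A \mid A$. The open assumptions of a derivation are those assumptions at its leaves that have not been discharged. *)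

theory Defs
  imports "HOL-Library.Multiset"
begin

datatype 'v fm = Var 'v | Stroke "'v fm" "'v fm" (infix "\<up>" 70)

fun holds :: "('v \<Rightarrow> bool) \<Rightarrow> 'v fm \<Rightarrow> bool" where
  "holds v (Var p) \<longleftrightarrow> v p"
| "holds v (A \<up> B) \<longleftrightarrow> \<not> holds v A \<or> \<not> holds v B"

text \<open>Nodes of a derivation carry a formula or the placeholder \<open>Bot\<close>, which is not a formula.\<close>

datatype 'v concl = Fm "'v fm" | Bot

text \<open>
  \<open>NS_C \<Gamma> C\<close>: there is a derivation tree with conclusion \<open>C\<close> whose open assumptions,
  one per undischarged leaf and hence counted with multiplicity, form the multiset \<open>\<Gamma>\<close>.
  A rule discharging any number of open assumptions \<open>A\<close> removes \<open>m\<close> copies of \<open>A\<close>, where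
  \<open>m = 0\<close> (vacuous discharge) and leaving further copies of \<open>A\<close> open in \<open>\<Gamma>\<close> are both allowed.
\<close>

inductive NS_C :: "'v fm multiset \<Rightarrow> 'v concl \<Rightarrow> bool" where
  Assumption: "NS_C {#A#} (Fm A)"
| StrokeI: "NS_C (\<Gamma> + replicate_mset m A + replicate_mset n B) Bot \<Longrightarrow> NS_C \<Gamma> (Fm (A \<up> B))"
| StrokeE: "NS_C \<Gamma> (Fm (A \<up> B)) \<Longrightarrow> NS_C \<Delta> (Fm A) \<Longrightarrow> NS_C \<Theta> (Fm B) \<Longrightarrow> NS_C (\<Gamma> + \<Delta> + \<Theta>) Bot"
| BotI: "NS_C \<Gamma> Bot \<Longrightarrow> NS_C \<Gamma> (Fm A)"
| StrokeEC: "NS_C (\<Gamma> + replicate_mset m (A \<up> A)) Bot \<Longrightarrow> NS_C \<Gamma> (Fm A)"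

end

theory Submission imports Defs begin

text \<open>
  Soundness is an induction on derivations. Completeness is Kalmar's argument. Let \<open>P\<close> be a
  finite set of variables and describe a valuation \<open>v\<close> on \<open>P\<close> by the literals \<open>p\<close> (if
  \<open>v p\<close>) and \<open>p \<up> p\<close> (if not), for \<open>p \<in> P\<close>. From these literals every formula over \<open>P\<close> that is true
  under \<open>v\<close> is derivable, and every formula over \<open>P\<close> that is false under \<open>v\<close> is refutable
  (\<open>kalmar\<close>). If \<open>\<Gamma>\<close> entails \<open>A\<close>, every valuation falsifies a member of \<open>\<Gamma> \<union> {A \<up> A}\<close>, so
  this set is refutable together with the literals of any \<open>v\<close>. The variables are then removed from
  \<open>P\<close> one at a time: a set refutable both with \<open>p\<close> and with \<open>p \<up> p\<close> is refutable
  (\<open>refutable_if_literals_refutable\<close>). Hence \<open>\<Gamma> \<union> {A \<up> A}\<close> is refutable, and the classical rule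
  \<open>StrokeEC\<close> yields \<open>A\<close> from \<open>\<Gamma>\<close>.
\<close>

lemma soundness:
  "NS_C \<Delta> C \<Longrightarrow> (\<forall>B\<in>#\<Delta>. holds v B) \<longrightarrow> (case C of Fm A \<Rightarrow> holds v A | Bot \<Rightarrow> False)"
  by (induction rule: NS_C.induct) (auto split: if_splits)

text \<open>
  Derivability from a set: the open assumptions belong to the set, and their multiplicities are
  forgotten. In this form the rules discharge a formula by deleting it from the set, and weakening
  is monotonicity.
\<close>

definition derivable :: "'v fm set \<Rightarrow> 'v concl \<Rightarrow> bool" where
  "derivable S C \<longleftrightarrow> (\<exists>\<Delta>. NS_C \<Delta> C \<and> set_mset \<Delta> \<subseteq> S)"

lemma derivable_mono: "derivable S C \<Longrightarrow> S \<subseteq> T \<Longrightarrow> derivable T C"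
  unfolding derivable_def by blast

lemma derivable_assumption: "A \<in> S \<Longrightarrow> derivable S (Fm A)"
  unfolding derivable_def using NS_C.Assumption[of A] by fastforce

lemma split_off_replicate_mset:
  assumes "set_mset \<Delta> \<subseteq> insert A S"
  obtains \<Gamma> m where "\<Delta> = \<Gamma> + replicate_mset m A" "set_mset \<Gamma> \<subseteq> S"
proof
  show "\<Delta> = filter_mset (\<lambda>B. B \<noteq> A) \<Delta> + replicate_mset (count \<Delta> A) A"
    by (rule multiset_eqI) auto
  show "set_mset (filter_mset (\<lambda>B. B \<noteq> A) \<Delta>) \<subseteq> S"
    using assms by auto
qed

lemma derivable_StrokeI:
  assumes "derivable (insert A (insert B S)) Bot"
  shows "derivable S (Fm (A \<up> B))"
proof -
  from assms obtain \<Delta> where \<Delta>: "NS_C \<Delta> Bot" "set_mset \<Delta> \<subseteq> insert A (insert B S)"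
    unfolding derivable_def by blast
  obtain \<Delta>' m where 1: "\<Delta> = \<Delta>' + replicate_mset m A" "set_mset \<Delta>' \<subseteq> insert B S"
    using split_off_replicate_mset[OF \<Delta>(2)] .
  obtain \<Gamma> n where 2: "\<Delta>' = \<Gamma> + replicate_mset n B" "set_mset \<Gamma> \<subseteq> S"
    using split_off_replicate_mset[OF 1(2)] .
  have "NS_C (\<Gamma> + replicate_mset m A + replicate_mset n B) Bot"
    using \<Delta>(1) 1(1) 2(1) by (simp add: ac_simps)
  then show ?thesis
    unfolding derivable_def using NS_C.StrokeI 2(2) by blast
qed

lemma derivable_StrokeE:
  assumes "derivable S (Fm (A \<up> B))" "derivable S (Fm A)" "derivable S (Fm B)"
  shows "derivable S Bot"
proof -
  from assms obtain \<Gamma> \<Delta> \<Theta> where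
    "NS_C \<Gamma> (Fm (A \<up> B))" "NS_C \<Delta> (Fm A)" "NS_C \<Theta> (Fm B)"
    and sub: "set_mset \<Gamma> \<subseteq> S" "set_mset \<Delta> \<subseteq> S" "set_mset \<Theta> \<subseteq> S"
    unfolding derivable_def by blast
  then have "NS_C (\<Gamma> + \<Delta> + \<Theta>) Bot"
    by (blast intro: NS_C.StrokeE)
  moreover have "set_mset (\<Gamma> + \<Delta> + \<Theta>) \<subseteq> S"
    using sub by simp
  ultimately show ?thesis
    unfolding derivable_def by blast
qed

lemma derivable_StrokeEC:
  assumes "derivable (insert (A \<up> A) S) Bot"
  shows "derivable S (Fm A)"
proof -
  from assms obtain \<Delta> where \<Delta>: "NS_C \<Delta> Bot" "set_mset \<Delta> \<subseteq> insert (A \<up> A) S"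
    unfolding derivable_def by blast
  obtain \<Gamma> m where "\<Delta> = \<Gamma> + replicate_mset m (A \<up> A)" "set_mset \<Gamma> \<subseteq> S"
    using split_off_replicate_mset[OF \<Delta>(2)] .
  with \<Delta>(1) show ?thesis
    unfolding derivable_def using NS_C.StrokeEC by blast
qed

text \<open>The literal of \<open>p\<close> that is true under \<open>v\<close>; \<open>A \<up> A\<close> is the negation of \<open>A\<close>.\<close>

definition literal :: "('v \<Rightarrow> bool) \<Rightarrow> 'v \<Rightarrow> 'v fm" where
  "literal v p = (if v p then Var p else Var p \<up> Var p)"

lemma kalmar:
  assumes "set_fm A \<subseteq> P"
  shows "(holds v A \<longrightarrow> derivable (literal v ` P) (Fm A)) \<and>
         (\<not> holds v A \<longrightarrow> derivable (insert A (literal v ` P)) Bot)"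
  using assms
proof (induction A)
  case (Var p)
  then have lit: "literal v p \<in> literal v ` P"
    by simp
  show ?case
  proof (cases "v p")
    case True
    with lit show ?thesis
      by (simp add: literal_def derivable_assumption)
  next
    case False
    with lit have "Var p \<up> Var p \<in> insert (Var p) (literal v ` P)"
      by (simp add: literal_def)
    with False show ?thesis
      by (auto intro!: derivable_StrokeE[of _ "Var p" "Var p"] derivable_assumption)
  qed
next
  case (Stroke A B)
  let ?L = "literal v ` P"
  show ?case
  proof (cases "holds v (A \<up> B)")
    case True
    with Stroke have "derivable (insert A ?L) Bot \<or> derivable (insert B ?L) Bot"
      by auto
    then have "derivable (insert A (insert B ?L)) Bot"
      by (blast intro: derivable_mono)
    with True show ?thesis
      by (blast intro: derivable_StrokeI)
  next
    case False
    with Stroke have "derivable ?L (Fm A)" "derivable ?L (Fm B)"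
      by auto
    then have "derivable (insert (A \<up> B) ?L) Bot"
      by (blast intro: derivable_StrokeE derivable_assumption derivable_mono)
    with False show ?thesis
      by blast
  qed
qed

lemma refutable_by_cases:
  assumes "derivable (insert A S) Bot" "derivable (insert (A \<up> A) S) Bot"
  shows "derivable S Bot"
proof -
  have "derivable S (Fm (A \<up> A))"
    using assms(1) by (simp add: derivable_StrokeI)
  moreover have "derivable S (Fm A)"
    using assms(2) by (rule derivable_StrokeEC)
  ultimately show ?thesis
    by (blast intro: derivable_StrokeE)
qed

lemma refutable_if_literals_refutable:
  assumes "finite P" "\<And>v. derivable (S \<union> literal v ` P) Bot"
  shows "derivable S Bot"
  using assms
proof (induction P)
  case empty
  then show ?case by simp
next
  case (insert p P)
  show ?case
  proof (rule insert.IH)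
    fix v
    have "derivable (insert (literal (v(p := b)) p) (S \<union> literal v ` P)) Bot" for b
    proof -
      \<comment> \<open>As \<open>p \<notin> P\<close>, the literals over \<open>P\<close> do not see the change of \<open>v\<close> at \<open>p\<close>.\<close>
      have "literal (v(p := b)) ` P = literal v ` P"
        using insert.hyps(2) by (intro image_cong) (auto simp: literal_def)
      then show ?thesis
        using insert.prems[of "v(p := b)"] by (metis Un_insert_right image_insert)
    qed
    from this[of True] this[of False] show "derivable (S \<union> literal v ` P) Bot"
      by (auto simp: literal_def intro: refutable_by_cases)
  qed
qed

lemma finite_set_fm: "finite (set_fm A)"
  by (induction A) auto

lemma refutable_if_unsatisfiable:
  assumes "finite S" "\<And>v. \<exists>B\<in>S. \<not> holds v B"
  shows "derivable S Bot"
proof (rule refutable_if_literals_refutable)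
  let ?P = "\<Union>B\<in>S. set_fm B"
  show "finite ?P"
    using assms(1) by (simp add: finite_set_fm)
  fix v
  obtain B where B: "B \<in> S" "\<not> holds v B"
    using assms(2) by blast
  then have "derivable (insert B (literal v ` ?P)) Bot"
    using kalmar[of B ?P v] by blast
  then show "derivable (S \<union> literal v ` ?P) Bot"
    by (rule derivable_mono) (use B in blast)
qed

theorem proposition5:
  fixes \<Gamma> :: "'v fm set" and A :: "'v fm"
  assumes "finite \<Gamma>"
  shows "(\<exists>\<Delta>. NS_C \<Delta> (Fm A) \<and> set_mset \<Delta> \<subseteq> \<Gamma>) \<longleftrightarrow>
         (\<forall>v. (\<forall>B\<in>\<Gamma>. holds v B) \<longrightarrow> holds v A)"
proof
  assume "\<exists>\<Delta>. NS_C \<Delta> (Fm A) \<and> set_mset \<Delta> \<subseteq> \<Gamma>"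
  then show "\<forall>v. (\<forall>B\<in>\<Gamma>. holds v B) \<longrightarrow> holds v A"
    using soundness by fastforce
next
  assume "\<forall>v. (\<forall>B\<in>\<Gamma>. holds v B) \<longrightarrow> holds v A"
  then have "derivable (insert (A \<up> A) \<Gamma>) Bot"
    using assms by (intro refutable_if_unsatisfiable) auto
  then show "\<exists>\<Delta>. NS_C \<Delta> (Fm A) \<and> set_mset \<Delta> \<subseteq> \<Gamma>"
    using derivable_StrokeEC derivable_def by blast
qed

end
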